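(* Let $n \geq 3$ and let $GP(n,1)$ be the prism graph. Then $Z_{(\ell)}(GP(n,1)) = 3$ if $\ell \in \{0,1\}$ and $n=3$; $Z_{(\ell)}(GP(n,1)) = 4$ if $\ell\in\{0,1\}$ and $n \geq 4$, or if $\ell = 2$ and $n = 3$; and $Z_{(\ell)}(GP(n,1)) = 2n$ if $\ell \geq 3$. Furthermore, $Z_{(2)}(GP(3,1)) = 4$, $Z_{(2)}(GP(4,1)) \leq 6$, and $Z_{(2)}(GP(n,1)) \leq n$ for $n > 4$.
   Context: Let $G=(V,E)$ be a finite simple graph. Color change rule: a colored (blue) vertex $v$ colors (forces) an uncolored vertex $u$ if $u$ is the only uncolored neighbor of $v$. In $\ell$-leaky forcing, after an initial set $B\subseteq V$ is colored, an adversary places leaks on at most $\ell$ vertices; a vertex with a leak never forces. $B$ is an $\ell$-leaky forcing set if for every placement of at most $\ell$ leaks, repeatedly applying the color change rule (with leaky vertices unable to force) eventually colors all of $V$. $Z_{(\ell)}(G)$ is the minimum size of an $\ell$-leaky forcing set ($\ell = 0$ is ordinary zero forcing). The prism graph $GP(n,1)$ consists of two vertex-disjoint $n$-cycles $u_1,\dots,u_n$ and $x_1,\dots,x_n$ together with the $n$ edges $u_ix_i$, $1\le i\le n$. *)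

theory Defs
  imports "Graph_Theory.Pair_Digraph"
begin

text \<open>
  A finite simple graph is a \<^locale>\<open>pair_graph\<close>: a finite, loop-free, symmetric digraph
  without parallel arcs. An edge is present as both of its arcs.
\<close>

definition neighbors :: "'a pair_pre_digraph \<Rightarrow> 'a \<Rightarrow> 'a set" where
  "neighbors G v = {u. (v, u) \<in> parcs G}"

text \<open>One application of the color change rule when the leaks are at \<open>L\<close>; a state is the set
  of colored vertices.\<close>

inductive force_step :: "'a pair_pre_digraph \<Rightarrow> 'a set \<Rightarrow> 'a set \<Rightarrow> 'a set \<Rightarrow> bool"
  for G :: "'a pair_pre_digraph" and L :: "'a set" where
  force: "\<lbrakk>v \<in> C; v \<notin> L; neighbors G v - C = {u}\<rbrakk> \<Longrightarrow> force_step G L C (insert u C)"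

text \<open>Forces stay available as more vertices get colored, so ``eventually colors all of \<open>V\<close>''
  does not depend on the order of the forces: it holds iff some sequence of steps reaches \<open>V\<close>.\<close>

definition leaky_forcing_set :: "'a pair_pre_digraph \<Rightarrow> nat \<Rightarrow> 'a set \<Rightarrow> bool" where
  "leaky_forcing_set G l B \<longleftrightarrow>
     B \<subseteq> pverts G \<and>
     (\<forall>L \<subseteq> pverts G. card L \<le> l \<longrightarrow> (force_step G L)\<^sup>*\<^sup>* B (pverts G))"

definition leaky_forcing_number :: "nat \<Rightarrow> 'a pair_pre_digraph \<Rightarrow> nat" where
  "leaky_forcing_number l G = (LEAST k. \<exists>B. leaky_forcing_set G l B \<and> card B = k)"

lemma leaky_forcing_set_pverts: "leaky_forcing_set G l (pverts G)"
  by (simp add: leaky_forcing_set_def)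

lemma leaky_forcing_number_attained:
  "\<exists>B. leaky_forcing_set G l B \<and> card B = leaky_forcing_number l G"
  unfolding leaky_forcing_number_def
  by (rule LeastI_ex) (use leaky_forcing_set_pverts in blast)

lemma leaky_forcing_number_le:
  "leaky_forcing_set G l B \<Longrightarrow> leaky_forcing_number l G \<le> card B"
  unfolding leaky_forcing_number_def by (rule Least_le) blast

datatype prism_vertex = U nat | X nat

text \<open>Indices run through \<open>{1..n}\<close>; \<open>i mod n + 1\<close> is the cyclic successor of \<open>i\<close>, so
  \<open>n\<close> is followed by \<open>1\<close>.\<close>

definition prism_arcs :: "nat \<Rightarrow> prism_vertex rel" where
  "prism_arcs n =
     (\<lambda>i. (U i, U (i mod n + 1))) ` {1..n} \<union>
     (\<lambda>i. (X i, X (i mod n + 1))) ` {1..n} \<union>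
     (\<lambda>i. (U i, X i)) ` {1..n}"

definition prism :: "nat \<Rightarrow> prism_vertex pair_pre_digraph" where
  "prism n = \<lparr> pverts = U ` {1..n} \<union> X ` {1..n}, parcs = prism_arcs n \<union> (prism_arcs n)\<inverse> \<rparr>"

lemma pair_graph_prism:
  assumes "n \<ge> 3"
  shows "pair_graph (prism n)"
proof -
  have suc_in: "i mod n + 1 \<in> {1..n}" for i
    using assms by (simp add: Suc_le_eq)
  have suc_neq: "i mod n + 1 \<noteq> i" if "i \<in> {1..n}" for i
    using that assms by (cases "i = n") auto
  have verts: "a \<in> pverts (prism n)" "b \<in> pverts (prism n)" "a \<noteq> b"
    if "(a, b) \<in> prism_arcs n" for a b
    using that suc_in suc_neq unfolding prism_arcs_def prism_def by fastforce+
  have fin: "finite (prism_arcs n)"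
    by (simp add: prism_arcs_def)
  show ?thesis
  proof unfold_locales
    show "finite (pverts (prism n))" by (simp add: prism_def)
    show "finite (parcs (prism n))" using fin by (simp add: prism_def)
    show "symmetric (with_proj (prism n))"
      by (auto simp: symmetric_def prism_def intro!: symI)
  next
    fix e assume "e \<in> parcs (prism n)"
    then have "e \<in> prism_arcs n \<or> prod.swap e \<in> prism_arcs n"
      by (auto simp: prism_def)
    then show "fst e \<in> pverts (prism n)" "snd e \<in> pverts (prism n)" "fst e \<noteq> snd e"
      using verts by (cases e; fastforce)+
  qed
qed

end

theory Submission
  imports Defs
begin

text \<open>
  Leaky forcing is dual to a fort condition: \<open>B\<close> fails against \<open>l\<close> leaks iff some nonempty
  set \<open>W\<close> of vertices avoiding \<open>B\<close> has at most \<open>l\<close> outside vertices with exactly one neighbor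
  in \<open>W\<close>, because leaking precisely those vertices keeps \<open>W\<close> uncolored forever. Every bound
  is a count of such boundary vertices. A single vertex has a boundary of size 3, which settles
  \<open>l \<ge> 3\<close>. For \<open>n \<ge> 4\<close> the prism is triangle-free and cubic, so the complement of a closed
  neighborhood has empty boundary, whence \<open>Z \<ge> 4\<close>. The upper bounds come from the \<open>U\<close>-cycle,
  from two adjacent columns, and from all columns but one.
\<close>

section \<open>Duality between leaky forcing and fort boundaries\<close>

definition fort_boundary :: "'a pair_pre_digraph \<Rightarrow> 'a set \<Rightarrow> 'a set" where
  "fort_boundary G W = {v \<in> pverts G - W. card (neighbors G v \<inter> W) = 1}"

lemma fort_boundaryI:
  "\<lbrakk>v \<in> pverts G; v \<notin> W; neighbors G v \<inter> W = {u}\<rbrakk> \<Longrightarrow> v \<in> fort_boundary G W"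
  by (simp add: fort_boundary_def)

lemma (in pair_graph) neighbors_subset: "neighbors G v \<subseteq> pverts G"
  unfolding neighbors_def using in_arcsD2 by blast

lemma (in pair_graph) neighbors_sym: "u \<in> neighbors G v \<longleftrightarrow> v \<in> neighbors G u"
  unfolding neighbors_def mem_Collect_eq by (rule iffI; erule arcs_symmetric)

lemma (in pair_graph) not_neighbor_self: "v \<notin> neighbors G v"
  using no_loops' unfolding neighbors_def by blast

lemma (in pair_graph) finite_neighbors: "finite (neighbors G v)"
  by (rule finite_subset[OF neighbors_subset pair_finite_verts])

lemma (in pair_graph) finite_fort_boundary: "finite (fort_boundary G W)"
  by (rule finite_subset[OF _ pair_finite_verts]) (auto simp: fort_boundary_def)

text \<open>As long as all of \<open>W\<close> is uncolored, a vertex forcing into \<open>W\<close>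
  has its target as its only neighbor in \<open>W\<close>. It is then a boundary vertex, hence
  leaky, and cannot force.\<close>

lemma (in pair_graph) fort_stays_uncolored:
  assumes "(force_step G (fort_boundary G W))\<^sup>*\<^sup>* B C" and "B \<subseteq> pverts G - W"
  shows "C \<subseteq> pverts G - W"
  using assms
proof (induction rule: rtranclp_induct)
  case base
  then show ?case .
next
  case (step C D)
  from step.hyps(2) show ?case
  proof cases
    case (force v u)
    have C: "C \<subseteq> pverts G - W" using step by blast
    have u: "u \<in> pverts G" using force neighbors_subset by blast
    have "u \<notin> W"
    proof
      assume "u \<in> W"
      then have "neighbors G v \<inter> W = {u}" using force C by blast
      then have "v \<in> fort_boundary G W"
        using force C by (intro fort_boundaryI) auto
      then show False using force by blast
    qed
    then show ?thesis using force C u by blast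
  qed
qed

text \<open>A stalled coloring would have an uncolored set whose whole boundary is leaky. So a
  non-leaky boundary vertex of the uncolored set always exists, and the number of uncolored vertices
  drops until none remain.\<close>

lemma (in pair_graph) forcing_reaches_verts:
  assumes no_fort: "\<And>W. \<lbrakk>W \<noteq> {}; W \<subseteq> pverts G - B\<rbrakk> \<Longrightarrow> \<not> fort_boundary G W \<subseteq> L"
    and "B \<subseteq> pverts G"
  shows "(force_step G L)\<^sup>*\<^sup>* B (pverts G)"
proof -
  have "(force_step G L)\<^sup>*\<^sup>* C (pverts G)" if "B \<subseteq> C" "C \<subseteq> pverts G" for C
    using that
  proof (induction "card (pverts G - C)" arbitrary: C rule: less_induct)
    case less
    show ?case
    proof (cases "C = pverts G")
      case False
      then obtain v where v: "v \<in> fort_boundary G (pverts G - C)" "v \<notin> L"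
        using no_fort[of "pverts G - C"] less.prems by blast
      \<comment> \<open>Hence the boundary vertices of the uncolored set are exactly the colored
        vertices that the color change rule lets force.\<close>
      have "neighbors G v \<inter> (pverts G - C) = neighbors G v - C"
        using neighbors_subset by blast
      then obtain u where u: "neighbors G v - C = {u}"
        using v by (auto simp: fort_boundary_def card_1_singleton_iff)
      then have uV: "u \<in> pverts G - C" using neighbors_subset by blast
      have "force_step G L C (insert u C)"
        using v u by (intro force_step.force) (auto simp: fort_boundary_def)
      moreover have "card (pverts G - insert u C) < card (pverts G - C)"
        using uV by (intro psubset_card_mono) auto
      then have "(force_step G L)\<^sup>*\<^sup>* (insert u C) (pverts G)"
        using less uV by blast
      ultimately show ?thesis by (rule converse_rtranclp_into_rtranclp)
    qed simp
  qed
  then show ?thesis using assms by blast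
qed

lemma (in pair_graph) leaky_forcing_set_iff:
  "leaky_forcing_set G l B \<longleftrightarrow>
     B \<subseteq> pverts G \<and> (\<forall>W. W \<noteq> {} \<and> W \<subseteq> pverts G - B \<longrightarrow> l < card (fort_boundary G W))"
proof (intro iffI conjI allI impI)
  fix W assume B: "leaky_forcing_set G l B" and W: "W \<noteq> {} \<and> W \<subseteq> pverts G - B"
  show "l < card (fort_boundary G W)"
  proof (rule ccontr)
    \<comment> \<open>The adversary can then afford to leak the entire boundary of
      \<open>W\<close>.\<close>
    assume "\<not> l < card (fort_boundary G W)"
    then have "(force_step G (fort_boundary G W))\<^sup>*\<^sup>* B (pverts G)"
      using B by (auto simp: leaky_forcing_set_def fort_boundary_def)
    moreover have "B \<subseteq> pverts G" using B by (simp add: leaky_forcing_set_def)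
    then have "B \<subseteq> pverts G - W" using W by blast
    ultimately have "pverts G \<subseteq> pverts G - W" by (rule fort_stays_uncolored)
    then show False using W by blast
  qed
next
  assume *: "B \<subseteq> pverts G \<and> (\<forall>W. W \<noteq> {} \<and> W \<subseteq> pverts G - B \<longrightarrow> l < card (fort_boundary G W))"
  show "leaky_forcing_set G l B"
    unfolding leaky_forcing_set_def
  proof (intro conjI allI impI)
    fix L assume L: "L \<subseteq> pverts G" "card L \<le> l"
    have "finite L" by (rule finite_subset[OF L(1) pair_finite_verts])
    show "(force_step G L)\<^sup>*\<^sup>* B (pverts G)"
    proof (rule forcing_reaches_verts)
      fix W assume "W \<noteq> {}" "W \<subseteq> pverts G - B"
      then have "l < card (fort_boundary G W)" using * by blast
      then show "\<not> fort_boundary G W \<subseteq> L"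
        using L(2) card_mono[OF \<open>finite L\<close>, of "fort_boundary G W"] by linarith
    qed (use * in blast)
  qed (use * in blast)
qed (auto simp: leaky_forcing_set_def)

lemma (in pair_graph) leaky_forcing_setD:
  "\<lbrakk>leaky_forcing_set G l B; W \<noteq> {}; W \<subseteq> pverts G - B\<rbrakk> \<Longrightarrow> l < card (fort_boundary G W)"
  by (simp add: leaky_forcing_set_iff)

section \<open>Bounds for general graphs from degrees and triangle-freeness\<close>

lemma leaky_forcing_number_mono:
  assumes "k \<le> l"
  shows "leaky_forcing_number k G \<le> leaky_forcing_number l G"
proof -
  obtain B where "leaky_forcing_set G l B" "card B = leaky_forcing_number l G"
    using leaky_forcing_number_attained by blast
  then show ?thesis
    using assms leaky_forcing_number_le[of G k B] by (auto simp: leaky_forcing_set_def)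
qed

lemma leaky_forcing_number_ge:
  assumes "\<And>B. leaky_forcing_set G l B \<Longrightarrow> m \<le> card B"
  shows "m \<le> leaky_forcing_number l G"
  using assms leaky_forcing_number_attained[of G l] by metis

text \<open>A single uncolored vertex \<open>w\<close> is a fort whose boundary lies among its at
  most \<open>l\<close> neighbors: leaking all of them isolates \<open>w\<close>.\<close>

lemma (in pair_graph) leaky_forcing_set_max_degree:
  assumes "\<And>v. v \<in> pverts G \<Longrightarrow> card (neighbors G v) \<le> l" and B: "leaky_forcing_set G l B"
  shows "B = pverts G"
proof (rule ccontr)
  assume "B \<noteq> pverts G"
  then obtain w where w: "w \<in> pverts G" "w \<notin> B"
    using B by (auto simp: leaky_forcing_set_def)
  have "fort_boundary G {w} \<subseteq> neighbors G w"
  proof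
    fix x assume "x \<in> fort_boundary G {w}"
    then have "neighbors G x \<inter> {w} \<noteq> {}" by (force simp: fort_boundary_def)
    then show "x \<in> neighbors G w" using neighbors_sym[of w x] by simp
  qed
  then have "card (fort_boundary G {w}) \<le> card (neighbors G w)"
    by (rule card_mono[OF finite_neighbors])
  moreover have "l < card (fort_boundary G {w})"
    using w by (intro leaky_forcing_setD[OF B]) auto
  ultimately show False using assms(1)[OF w(1)] by simp
qed

lemma (in pair_graph) leaky_forcing_number_max_degree:
  assumes "\<And>v. v \<in> pverts G \<Longrightarrow> card (neighbors G v) \<le> l"
  shows "leaky_forcing_number l G = card (pverts G)"
  using leaky_forcing_number_attained[of G l] leaky_forcing_set_max_degree[OF assms] by metis

lemma (in pair_graph) first_force:
  assumes B: "leaky_forcing_set G l B" and "B \<noteq> pverts G"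
  obtains v where "v \<in> B" "card (neighbors G v - B) = 1"
proof -
  have "l < card (fort_boundary G (pverts G - B))"
    using assms by (intro leaky_forcing_setD[OF B]) (auto simp: leaky_forcing_set_def)
  then have "fort_boundary G (pverts G - B) \<noteq> {}" by auto
  moreover have "neighbors G v \<inter> (pverts G - B) = neighbors G v - B" for v
    using neighbors_subset by blast
  ultimately show ?thesis using that by (auto simp: fort_boundary_def)
qed

text \<open>The first vertex to force is colored together with all but one of its neighbors, which
  already makes as many colored vertices as its degree.\<close>

lemma (in pair_graph) min_degree_card_ge:
  assumes deg: "\<And>v. v \<in> pverts G \<Longrightarrow> d \<le> card (neighbors G v)"
    and ne: "pverts G \<noteq> {}" and B: "leaky_forcing_set G l B"
  shows "d \<le> card B"
proof -
  have BV: "B \<subseteq> pverts G" using B by (simp add: leaky_forcing_set_def)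
  have fB: "finite B" by (rule finite_subset[OF BV pair_finite_verts])
  show ?thesis
  proof (cases "B = pverts G")
    case True
    obtain v where v: "v \<in> pverts G" using ne by blast
    have "card (neighbors G v) \<le> card B"
      using True fB neighbors_subset by (intro card_mono) auto
    then show ?thesis using deg[OF v] by simp
  next
    case False
    obtain v where v: "v \<in> B" "card (neighbors G v - B) = 1"
      using first_force[OF B False] .
    have "card (insert v (neighbors G v \<inter> B)) \<le> card B"
      using v fB by (intro card_mono) auto
    moreover have "card (insert v (neighbors G v \<inter> B)) = Suc (card (neighbors G v \<inter> B))"
      using not_neighbor_self fB by (intro card_insert_disjoint) auto
    moreover have "card (neighbors G v) = card (neighbors G v \<inter> B) + card (neighbors G v - B)"
      by (rule card_Int_Diff[OF finite_neighbors])
    moreover have "d \<le> card (neighbors G v)" using deg v BV by blast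
    ultimately show ?thesis using v by simp
  qed
qed

text \<open>With at most \<open>d\<close> vertices, \<open>B\<close> would lie in the closed
  neighborhood of the first forcing vertex \<open>v\<close>. The complement \<open>W\<close> of that
  neighborhood has empty boundary: \<open>v\<close> sees nothing of it, and each neighbor of
  \<open>v\<close> has, without triangles, its \<open>d - 1\<close> other neighbors there, which is
  at least two.\<close>

lemma (in pair_graph) triangle_free_card_gt:
  assumes deg: "\<And>v. v \<in> pverts G \<Longrightarrow> card (neighbors G v) = d" and d: "3 \<le> d"
    and tri: "\<And>u v w. \<lbrakk>u \<in> neighbors G v; w \<in> neighbors G v\<rbrakk> \<Longrightarrow> w \<notin> neighbors G u"
    and ne: "pverts G \<noteq> {}" and B: "leaky_forcing_set G l B"
  shows "d < card B"
proof (rule ccontr)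
  assume "\<not> d < card B"
  then have cB: "card B \<le> d" by simp
  have BV: "B \<subseteq> pverts G" using B by (simp add: leaky_forcing_set_def)
  have fB: "finite B" by (rule finite_subset[OF BV pair_finite_verts])
  have big: "card (insert v (neighbors G v)) = Suc d" if "v \<in> pverts G" for v
    using that deg not_neighbor_self finite_neighbors by simp
  have "B \<noteq> pverts G"
  proof
    assume eq: "B = pverts G"
    obtain v where v: "v \<in> pverts G" using ne by blast
    have "card (insert v (neighbors G v)) \<le> card B"
      using eq v fB neighbors_subset by (intro card_mono) auto
    then show False using big[OF v] cB by simp
  qed
  then obtain v where v: "v \<in> B" "card (neighbors G v - B) = 1"
    using first_force[OF B] by metis
  have vV: "v \<in> pverts G" using v BV by blast
  have "card (insert v (neighbors G v \<inter> B)) = Suc (card (neighbors G v \<inter> B))"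
    using not_neighbor_self fB by (intro card_insert_disjoint) auto
  moreover have "card (neighbors G v) = card (neighbors G v \<inter> B) + card (neighbors G v - B)"
    by (rule card_Int_Diff[OF finite_neighbors])
  \<comment> \<open>The vertex \<open>v\<close> and its \<open>d - 1\<close> colored neighbors
    exhaust the size allowed for \<open>B\<close>, so they are all of \<open>B\<close>.\<close>
  ultimately have "card B \<le> card (insert v (neighbors G v \<inter> B))"
    using deg[OF vV] v cB by simp
  then have "insert v (neighbors G v \<inter> B) = B"
    using v fB by (intro card_seteq) auto
  then have sub: "B \<subseteq> insert v (neighbors G v)" by blast
  define W where "W = pverts G - insert v (neighbors G v)"
  have two: "2 \<le> card (neighbors G w \<inter> W)" if w: "w \<in> neighbors G v" for w
  proof -
    have "neighbors G w \<inter> W = neighbors G w - {v}"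
      using tri[OF w] neighbors_subset not_neighbor_self unfolding W_def by blast
    moreover have "v \<in> neighbors G w" using w neighbors_sym by blast
    moreover have "w \<in> pverts G" using w neighbors_subset by blast
    ultimately show ?thesis using deg d finite_neighbors by simp
  qed
  have "card (neighbors G v) > 0" using deg[OF vV] d by simp
  then obtain w where "w \<in> neighbors G v" by (auto simp: card_gt_0_iff)
  then have "W \<noteq> {}" using two by fastforce
  then have "l < card (fort_boundary G W)"
    using sub by (intro leaky_forcing_setD[OF B]) (auto simp: W_def)
  moreover have "fort_boundary G W = {}"
  proof -
    have "x \<notin> fort_boundary G W" for x
    proof
      assume x: "x \<in> fort_boundary G W"
      then consider "x = v" | "x \<in> neighbors G v"
        by (auto simp: fort_boundary_def W_def)
      then show False
      proof cases
        case 1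
        have "neighbors G v \<inter> W = {}" by (auto simp: W_def)
        then show ?thesis using x 1 by (simp add: fort_boundary_def)
      next
        case 2
        then show ?thesis using two x by (fastforce simp: fort_boundary_def)
      qed
    qed
    then show ?thesis by blast
  qed
  ultimately show False by simp
qed

section \<open>Prisms\<close>

text \<open>Case distinctions replace \<open>mod\<close>, which keeps the index arithmetic linear;
  the agreement with \<open>i mod n + 1\<close> holds on \<open>{1..n}\<close>.\<close>

definition cyc_succ :: "nat \<Rightarrow> nat \<Rightarrow> nat" where
  "cyc_succ n i = (if i = n then 1 else i + 1)"

definition cyc_pred :: "nat \<Rightarrow> nat \<Rightarrow> nat" where
  "cyc_pred n i = (if i = 1 then n else i - 1)"

lemma pverts_prism: "pverts (prism n) = U ` {1..n} \<union> X ` {1..n}"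
  by (simp add: prism_def)

lemma card_pverts_prism: "card (pverts (prism n)) = 2 * n"
  unfolding pverts_prism by (subst card_Un_disjoint) (auto simp: card_image inj_on_def)

lemma cyc_succ_mod: "i \<in> {1..n} \<Longrightarrow> i mod n + 1 = cyc_succ n i"
  by (auto simp: cyc_succ_def)

lemma prism_arcs_iff:
  "(U i, U j) \<in> prism_arcs n \<longleftrightarrow> i \<in> {1..n} \<and> j = cyc_succ n i"
  "(X i, X j) \<in> prism_arcs n \<longleftrightarrow> i \<in> {1..n} \<and> j = cyc_succ n i"
  "(U i, X j) \<in> prism_arcs n \<longleftrightarrow> i \<in> {1..n} \<and> j = i"
  "(X i, U j) \<notin> prism_arcs n"
  by (auto simp: prism_arcs_def cyc_succ_mod[symmetric] image_iff)

text \<open>Resolves the reversed cycle arcs: an arc into index \<open>i\<close> starts at its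
  predecessor.\<close>

lemma cyc_succ_eq_iff:
  assumes "i \<in> {1..n}"
  shows "j \<in> {1..n} \<and> i = cyc_succ n j \<longleftrightarrow> j = cyc_pred n i"
  using assms by (auto simp: cyc_succ_def cyc_pred_def)

lemma neighbors_prism_U:
  assumes "i \<in> {1..n}"
  shows "neighbors (prism n) (U i) = {U (cyc_succ n i), U (cyc_pred n i), X i}"
proof -
  have "v \<in> neighbors (prism n) (U i) \<longleftrightarrow> v \<in> {U (cyc_succ n i), U (cyc_pred n i), X i}" for v
    using assms cyc_succ_eq_iff[OF assms]
    by (cases v) (auto simp: neighbors_def prism_def prism_arcs_iff)
  then show ?thesis by blast
qed

lemma neighbors_prism_X:
  assumes "i \<in> {1..n}"
  shows "neighbors (prism n) (X i) = {X (cyc_succ n i), X (cyc_pred n i), U i}"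
proof -
  have "v \<in> neighbors (prism n) (X i) \<longleftrightarrow> v \<in> {X (cyc_succ n i), X (cyc_pred n i), U i}" for v
    using assms cyc_succ_eq_iff[OF assms]
    by (cases v) (auto simp: neighbors_def prism_def prism_arcs_iff)
  then show ?thesis by blast
qed

lemma card_neighbors_prism:
  assumes "n \<ge> 3" "v \<in> pverts (prism n)"
  shows "card (neighbors (prism n) v) = 3"
proof -
  obtain i where i: "i \<in> {1..n}" "v = U i \<or> v = X i"
    using assms by (auto simp: pverts_prism)
  have "cyc_succ n i \<noteq> cyc_pred n i"
    using i assms by (auto simp: cyc_succ_def cyc_pred_def)
  then show ?thesis
    using i by (auto simp: neighbors_prism_U neighbors_prism_X)
qed

text \<open>The two cycle neighbors of a vertex are not adjacent once the cycles have length at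
  least 4, and its partner in the other cycle has no further neighbor in its own cycle. For
  \<open>n = 3\<close> each cycle is itself a triangle.\<close>

lemma prism_triangle_free:
  assumes n: "n \<ge> 4" and u: "u \<in> neighbors (prism n) v" and w: "w \<in> neighbors (prism n) v"
  shows "w \<notin> neighbors (prism n) u"
proof -
  interpret pair_graph "prism n" using n by (intro pair_graph_prism) simp
  have "v \<in> neighbors (prism n) u" using u by (simp add: neighbors_sym[of v])
  then have "v \<in> pverts (prism n)" by (rule subsetD[OF neighbors_subset])
  then obtain i where i: "i \<in> {1..n}" "v = U i \<or> v = X i"
    by (auto simp: pverts_prism)
  define s p where "s = cyc_succ n i" and "p = cyc_pred n i"
  note sp = s_def p_def cyc_succ_def cyc_pred_def
  have range: "s \<in> {1..n}" "p \<in> {1..n}"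
    using i n by (auto simp: sp)
  have "s \<noteq> i" "p \<noteq> i" "cyc_succ n s \<notin> {s, p}" "cyc_pred n s \<notin> {s, p}"
    "cyc_succ n p \<notin> {s, p}" "cyc_pred n p \<notin> {s, p}"
    using i n by (auto simp: sp)
  note neq = this
  have "neighbors (prism n) (U i) = {U s, U p, X i}" "neighbors (prism n) (X i) = {X s, X p, U i}"
    using i by (simp_all add: neighbors_prism_U neighbors_prism_X s_def p_def)
  note nb = this range[THEN neighbors_prism_U] range[THEN neighbors_prism_X]
  from i(2) show ?thesis
  proof
    assume v: "v = U i"
    show ?thesis
      using u w neq by (auto simp: v nb)
  next
    assume v: "v = X i"
    show ?thesis
      using u w neq by (auto simp: v nb)
  qed
qed

section \<open>Lower bounds for prisms\<close>

lemma prism_leaky_forcing_number_ge_3: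
  assumes "n \<ge> 3"
  shows "3 \<le> leaky_forcing_number l (prism n)"
proof (rule leaky_forcing_number_ge)
  interpret pair_graph "prism n" using assms by (rule pair_graph_prism)
  fix B assume "leaky_forcing_set (prism n) l B"
  moreover have "pverts (prism n) \<noteq> {}" using assms by (simp add: pverts_prism)
  ultimately show "3 \<le> card B"
    using min_degree_card_ge[of 3] card_neighbors_prism[OF assms] by simp
qed

lemma prism_leaky_forcing_number_ge_4:
  assumes "n \<ge> 4"
  shows "4 \<le> leaky_forcing_number l (prism n)"
proof (rule leaky_forcing_number_ge)
  interpret pair_graph "prism n" using assms by (intro pair_graph_prism) simp
  fix B assume B: "leaky_forcing_set (prism n) l B"
  have ne: "pverts (prism n) \<noteq> {}" using assms by (simp add: pverts_prism)
  have "3 < card B"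
    by (rule triangle_free_card_gt[OF card_neighbors_prism order_refl prism_triangle_free[OF assms] ne B])
      (use assms in auto)
  then show "4 \<le> card B" by simp
qed

text \<open>Each pair inside a triangle is a fort that two leaks defeat, so \<open>B\<close> must
  meet every such pair. It therefore contains at least two vertices of each of the two disjoint
  triangles.\<close>

lemma prism_3_two_leaks_ge_4: "4 \<le> leaky_forcing_number 2 (prism 3)"
proof (rule leaky_forcing_number_ge)
  interpret pair_graph "prism 3" by (rule pair_graph_prism) simp
  fix B assume B: "leaky_forcing_set (prism 3) 2 B"
  show "4 \<le> card B"
  proof (rule ccontr)
    assume small: "\<not> 4 \<le> card B"
    have idx: "{1..3} = {1, 2, 3::nat}" by auto
    have nb: "neighbors (prism 3) (U 1) = {U 2, U 3, X 1}"
      "neighbors (prism 3) (U 2) = {U 3, U 1, X 2}"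
      "neighbors (prism 3) (U 3) = {U 1, U 2, X 3}"
      "neighbors (prism 3) (X 1) = {X 2, X 3, U 1}"
      "neighbors (prism 3) (X 2) = {X 3, X 1, U 2}"
      "neighbors (prism 3) (X 3) = {X 1, X 2, U 3}"
      by (auto simp: neighbors_prism_U neighbors_prism_X cyc_succ_def cyc_pred_def)
    text \<open>Two vertices of the same triangle have a boundary of size 2, since the third vertex of
      that triangle sees both.\<close>
    have bd: "fort_boundary (prism 3) {U 1, U 2} \<subseteq> {X 1, X 2}"
      "fort_boundary (prism 3) {U 1, U 3} \<subseteq> {X 1, X 3}"
      "fort_boundary (prism 3) {U 2, U 3} \<subseteq> {X 2, X 3}"
      "fort_boundary (prism 3) {X 1, X 2} \<subseteq> {U 1, U 2}"
      "fort_boundary (prism 3) {X 1, X 3} \<subseteq> {U 1, U 3}"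
      "fort_boundary (prism 3) {X 2, X 3} \<subseteq> {U 2, U 3}"
      unfolding fort_boundary_def pverts_prism idx by (auto simp: nb[unfolded One_nat_def])
    have hit: "W \<inter> B \<noteq> {}"
      if "W \<subseteq> pverts (prism 3)" "W \<noteq> {}" "fort_boundary (prism 3) W \<subseteq> {a, b}" for W a b
    proof
      assume "W \<inter> B = {}"
      then have "2 < card (fort_boundary (prism 3) W)"
        using that by (intro leaky_forcing_setD[OF B]) auto
      also have "\<dots> \<le> card {a, b}" using that by (intro card_mono) auto
      also have "\<dots> \<le> 2" by (simp add: card_insert_if)
      finally show False by simp
    qed
    have hits: "U 1 \<in> B \<or> U 2 \<in> B" "U 1 \<in> B \<or> U 3 \<in> B" "U 2 \<in> B \<or> U 3 \<in> B"
      "X 1 \<in> B \<or> X 2 \<in> B" "X 1 \<in> B \<or> X 3 \<in> B" "X 2 \<in> B \<or> X 3 \<in> B"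
      using bd[THEN hit[rotated 2]] by (auto simp: pverts_prism)
    have two: "\<exists>i j. i \<noteq> j \<and> f i \<in> B \<and> f j \<in> B"
      if "f 1 \<in> B \<or> f 2 \<in> B" "f 1 \<in> B \<or> f 3 \<in> B" "f 2 \<in> B \<or> f 3 \<in> B"
      for f :: "nat \<Rightarrow> prism_vertex"
    proof -
      have "(1::nat) \<noteq> 2" "(1::nat) \<noteq> 3" "(2::nat) \<noteq> 3" by simp_all
      then show ?thesis using that by blast
    qed
    obtain i j k m where "{U i, U j, X k, X m} \<subseteq> B" "i \<noteq> j" "k \<noteq> m"
      using two[OF hits(1-3)] two[OF hits(4-6)] by blast
    moreover have "finite B"
      using B by (intro finite_subset[OF _ pair_finite_verts]) (simp add: leaky_forcing_set_def)
    ultimately have "card {U i, U j, X k, X m} \<le> card B"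
      by (intro card_mono)
    moreover have "card {U i, U j, X k, X m} = 4" using \<open>i \<noteq> j\<close> \<open>k \<noteq> m\<close> by simp
    ultimately show False using small by simp
  qed
qed

section \<open>Upper bounds for prisms\<close>

lemma (in pair_graph) card_gt_fort_boundaryI:
  assumes "S \<subseteq> fort_boundary G W" "l < card S"
  shows "l < card (fort_boundary G W)"
  using assms card_mono[OF finite_fort_boundary] by (meson less_le_trans)

text \<open>The columns meeting \<open>W\<close> lie between a first one \<open>a\<close> and a last
  one \<open>b\<close>. Just before \<open>a\<close> and just after \<open>b\<close> come two
  consecutive columns free of \<open>W\<close>, so the vertex next to a \<open>W\<close>-vertex of
  column \<open>a\<close> or \<open>b\<close> on the outer side sees only that vertex.\<close>

lemma prism_two_columns_leaky_forcing:
  assumes "n \<ge> 3"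
  shows "leaky_forcing_set (prism n) 1 {U 1, U 2, X 1, X 2}"
proof -
  interpret pair_graph "prism n" using assms by (rule pair_graph_prism)
  have "1 < card (fort_boundary (prism n) W)"
    if W: "W \<noteq> {}" "W \<subseteq> pverts (prism n) - {U 1, U 2, X 1, X 2}" for W
  proof -
    define I where "I = {i. U i \<in> W \<or> X i \<in> W}"
    have range: "i \<in> {3..n}" if "i \<in> I" for i
    proof -
      have "i \<in> {1..n}" "i \<noteq> 1" "i \<noteq> 2" using that W unfolding I_def pverts_prism by auto
      then show ?thesis by auto
    qed
    then have "I \<subseteq> {3..n}" by blast
    then have fin: "finite I" by (rule finite_subset) simp
    have ne: "I \<noteq> {}"
    proof -
      obtain w where "w \<in> W" using W by blast
      then show ?thesis unfolding I_def by (cases w) auto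
    qed
    have out: "U i \<notin> W" "X i \<notin> W" if "i \<notin> I" for i
      using that by (auto simp: I_def)
    define a where "a = Min I"
    define b where "b = Max I"
    have le: "a \<le> i" "i \<le> b" if "i \<in> I" for i
      using fin that by (simp_all add: a_def b_def)
    have "a \<in> I" "b \<in> I" using fin ne by (simp_all add: a_def b_def)
    note ab = this this[THEN range]
    \<comment> \<open>Since \<open>a\<close> is at least 3, neither subtraction leaves the index
      range \<open>{1..n}\<close>.\<close>
    have a: "a - 1 \<notin> I" "a - 2 \<notin> I"
      using ab le(1)[of "a - 1"] le(1)[of "a - 2"] by auto
    define c where "c = cyc_succ n b"
    have c: "c \<notin> I" "cyc_succ n c \<notin> I" "c \<in> {1..n}" "cyc_pred n c = b"
      using ab range[of c] range[of "cyc_succ n c"] le(2)[of c] le(2)[of "cyc_succ n c"]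
      by (auto simp: c_def cyc_succ_def cyc_pred_def split: if_splits)
    have cyc: "cyc_succ n (a - 1) = a" "cyc_pred n (a - 1) = a - 2" "a - 1 \<in> {1..n}"
      using ab by (auto simp: cyc_succ_def cyc_pred_def)
    \<comment> \<open>Either \<open>c = b + 1\<close> exceeds \<open>a - 1\<close>, or
      \<open>c\<close> has wrapped around to 1 while \<open>a - 1\<close> is at least 2.\<close>
    have "a - 1 \<noteq> c"
      using ab le(1)[OF ab(2)] by (auto simp: c_def cyc_succ_def split: if_splits)
    \<comment> \<open>The maps \<open>f\<close> and \<open>g\<close> select the cycle in which
      \<open>W\<close> meets column \<open>a\<close> and column \<open>b\<close>; the two choices
      may differ.\<close>
    obtain f where f: "f = U \<or> f = X" "f a \<in> W" using ab by (auto simp: I_def)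
    obtain g where g: "g = U \<or> g = X" "g b \<in> W" using ab by (auto simp: I_def)
    have "f (a - 1) \<in> fort_boundary (prism n) W"
    proof (rule fort_boundaryI)
      show "neighbors (prism n) (f (a - 1)) \<inter> W = {f a}"
        using f cyc out[OF a(1)] out[OF a(2)] by (auto simp: neighbors_prism_U neighbors_prism_X)
      show "f (a - 1) \<in> pverts (prism n)" using f(1) cyc(3) by (auto simp: pverts_prism)
      show "f (a - 1) \<notin> W" using f(1) out[OF a(1)] by blast
    qed
    moreover have "g c \<in> fort_boundary (prism n) W"
    proof (rule fort_boundaryI)
      show "neighbors (prism n) (g c) \<inter> W = {g b}"
        using g c out[OF c(1)] out[OF c(2)] by (auto simp: neighbors_prism_U neighbors_prism_X)
      show "g c \<in> pverts (prism n)" using g(1) c(3) by (auto simp: pverts_prism)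
      show "g c \<notin> W" using g(1) out[OF c(1)] by blast
    qed
    ultimately have S: "{f (a - 1), g c} \<subseteq> fort_boundary (prism n) W" by blast
    have "card {f (a - 1), g c} = 2"
      using f(1) g(1) \<open>a - 1 \<noteq> c\<close> by auto
    then show ?thesis by (intro card_gt_fort_boundaryI[OF S]) simp
  qed
  then show ?thesis
    using assms by (simp add: leaky_forcing_set_iff) (auto simp: pverts_prism)
qed

text \<open>Here \<open>W\<close> is a set of \<open>X\<close>-vertices, and each of their
  \<open>U\<close>-partners is a boundary vertex. This suffices when \<open>W\<close> has more than
  \<open>l\<close> elements; smaller \<open>W\<close> need additional boundary vertices on the
  \<open>X\<close>-cycle. For two leaks the set fails at \<open>n = 4\<close>, where opposite
  \<open>X\<close>-vertices gain none, and at \<open>n = 3\<close>, where the third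
  \<open>X\<close>-vertex sees both.\<close>

lemma prism_U_cycle_leaky_forcing:
  assumes "n \<ge> 3" and "l = 1 \<or> l = 2 \<and> n \<ge> 5"
  shows "leaky_forcing_set (prism n) l (U ` {1..n})"
proof -
  interpret pair_graph "prism n" using assms by (intro pair_graph_prism) simp
  have "l < card (fort_boundary (prism n) W)"
    if W: "W \<noteq> {}" "W \<subseteq> pverts (prism n) - U ` {1..n}" for W
  proof -
    define A where "A = {i. X i \<in> W}"
    have WA: "W = X ` A" using W by (auto simp: A_def pverts_prism)
    have sub: "A \<subseteq> {1..n}" using W by (auto simp: A_def pverts_prism)
    have fin: "finite A" by (rule finite_subset[OF sub]) simp
    have UA: "U ` A \<subseteq> fort_boundary (prism n) W"
      using sub by (auto simp: WA neighbors_prism_U pverts_prism intro!: fort_boundaryI)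
    have cU: "card (U ` A) = card A" by (simp add: card_image inj_on_def)
    have Xb: "X i \<in> fort_boundary (prism n) W"
      if "i \<in> {1..n}" "i \<notin> A" "(cyc_succ n i \<in> A) \<noteq> (cyc_pred n i \<in> A)" for i
    proof (cases "cyc_succ n i \<in> A")
      case True
      then show ?thesis
        using that by (intro fort_boundaryI[where u = "X (cyc_succ n i)"])
          (auto simp: WA neighbors_prism_X pverts_prism)
    next
      case False
      then show ?thesis
        using that by (intro fort_boundaryI[where u = "X (cyc_pred n i)"])
          (auto simp: WA neighbors_prism_X pverts_prism)
    qed
    have "card A \<noteq> 0" using W WA fin by auto
    then consider "card A = 1" | "card A = 2" "l = 1" | "card A = 2" "l = 2" | "card A > 2"
      using assms by linarith
    then show ?thesis
    proof cases
      case 1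
      then obtain a where a: "A = {a}" by (auto simp: card_1_singleton_iff)
      \<comment> \<open>All three neighbors of an isolated uncolored vertex are boundary
        vertices.\<close>
      let ?S = "{U a, X (cyc_succ n a), X (cyc_pred n a)}"
      have an: "a \<in> {1..n}" using a sub by auto
      have "X (cyc_succ n a) \<in> fort_boundary (prism n) W"
        by (rule Xb) (use assms a an in \<open>auto simp: cyc_succ_def cyc_pred_def\<close>)
      moreover have "X (cyc_pred n a) \<in> fort_boundary (prism n) W"
        by (rule Xb) (use assms a an in \<open>auto simp: cyc_succ_def cyc_pred_def\<close>)
      moreover have "cyc_succ n a \<noteq> cyc_pred n a"
        using assms an by (auto simp: cyc_succ_def cyc_pred_def)
      ultimately have S: "?S \<subseteq> fort_boundary (prism n) W" "card ?S = 3" using UA a by auto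
      have "l < card ?S" using S(2) assms(2) by linarith
      then show ?thesis by (rule card_gt_fort_boundaryI[OF S(1)])
    next
      case 2
      then show ?thesis using UA cU by (intro card_gt_fort_boundaryI[OF UA]) simp
    next
      case 3
      then have n5: "n \<ge> 5" using assms by simp
      obtain a b where ab: "A = {a, b}" "a \<noteq> b" using 3 by (auto simp: card_2_iff)
      have abn: "a \<in> {1..n}" "b \<in> {1..n}" using ab sub by auto
      text \<open>The extra boundary vertex is a neighbor of \<open>X a\<close> on the side away from \<open>X b\<close>. Only for
        \<open>n \<le> 4\<close> can \<open>X b\<close> be at distance at most 2 from \<open>X a\<close> on both sides.\<close>
      obtain i where i: "X i \<in> fort_boundary (prism n) W"
      proof (cases "b = cyc_succ n a \<or> b = cyc_succ n (cyc_succ n a)")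
        case True
        have "cyc_pred n a \<in> {1..n}" "cyc_succ n (cyc_pred n a) = a" "cyc_pred n a \<noteq> a"
          "cyc_pred n (cyc_pred n a) \<noteq> a"
          using abn n5 by (auto simp: cyc_succ_def cyc_pred_def)
        \<comment> \<open>One or two steps ahead of \<open>a\<close> means at least
          \<open>n - 2\<close>, hence at least 3, steps behind it.\<close>
        moreover have "cyc_pred n a \<noteq> b" "cyc_pred n (cyc_pred n a) \<noteq> b"
          using True abn(1) n5 by (auto simp: cyc_succ_def cyc_pred_def split: if_splits)
        ultimately have "X (cyc_pred n a) \<in> fort_boundary (prism n) W"
          using ab(1) by (intro Xb) simp_all
        then show ?thesis by (rule that)
      next
        case False
        have "cyc_succ n a \<in> {1..n}" "cyc_pred n (cyc_succ n a) = a" "cyc_succ n a \<noteq> a"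
          "cyc_succ n (cyc_succ n a) \<noteq> a"
          using abn n5 by (auto simp: cyc_succ_def cyc_pred_def)
        then have "X (cyc_succ n a) \<in> fort_boundary (prism n) W"
          using ab(1) False by (intro Xb) auto
        then show ?thesis by (rule that)
      qed
      have S: "insert (X i) (U ` A) \<subseteq> fort_boundary (prism n) W" using i UA by simp
      have "card (insert (X i) (U ` A)) = 3"
        using cU 3 fin by (subst card_insert_disjoint) auto
      then show ?thesis using 3 by (intro card_gt_fort_boundaryI[OF S]) simp
    next
      case 4
      then show ?thesis using UA cU assms by (intro card_gt_fort_boundaryI[OF UA]) auto
    qed
  qed
  then show ?thesis by (simp add: leaky_forcing_set_iff) (auto simp: pverts_prism)
qed

text \<open>Only three forts fit into one column, with at least 3, 3 and 4 boundary vertices. The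
  set serves \<open>n = 3\<close> and \<open>n = 4\<close>, where the \<open>U\<close>-cycle does
  not withstand two leaks.\<close>

lemma prism_all_but_one_column_leaky_forcing:
  assumes "n \<ge> 3"
  shows "leaky_forcing_set (prism n) 2 (pverts (prism n) - {U 1, X 1})"
proof -
  interpret pair_graph "prism n" using assms by (rule pair_graph_prism)
  have nb: "neighbors (prism n) (U 1) = {U 2, U n, X 1}" "neighbors (prism n) (X 1) = {X 2, X n, U 1}"
    "neighbors (prism n) (U 2) = {U (cyc_succ n 2), U 1, X 2}"
    "neighbors (prism n) (X 2) = {X (cyc_succ n 2), X 1, U 2}"
    "neighbors (prism n) (U n) = {U 1, U (n - 1), X n}"
    "neighbors (prism n) (X n) = {X 1, X (n - 1), U n}"
    using assms by (auto simp: neighbors_prism_U neighbors_prism_X cyc_succ_def cyc_pred_def)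
  have bd: "{U 2, U n, X 1} \<subseteq> fort_boundary (prism n) {U 1}"
    "{X 2, X n, U 1} \<subseteq> fort_boundary (prism n) {X 1}"
    "{U 2, U n, X 2, X n} \<subseteq> fort_boundary (prism n) {U 1, X 1}"
    unfolding fort_boundary_def pverts_prism
    using assms by (auto simp: nb[unfolded One_nat_def] cyc_succ_def)
  have "2 < card (fort_boundary (prism n) W)" if "W \<noteq> {}" "W \<subseteq> {U 1, X 1}" for W
  proof -
    from that consider "W = {U 1}" | "W = {X 1}" | "W = {U 1, X 1}" by blast
    then show ?thesis
    proof cases
      case 1
      then show ?thesis
        using card_gt_fort_boundaryI[OF bd(1), of 2] assms by simp
    next
      case 2
      then show ?thesis
        using card_gt_fort_boundaryI[OF bd(2), of 2] assms by simp
    next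
      case 3
      then show ?thesis
        using card_gt_fort_boundaryI[OF bd(3), of 2] assms by simp
    qed
  qed
  then show ?thesis by (simp add: leaky_forcing_set_iff) blast
qed

lemma prism_two_leaks_le:
  assumes "n \<ge> 3"
  shows "leaky_forcing_number 2 (prism n) \<le> 2 * n - 2"
proof -
  have "card (pverts (prism n) - {U 1, X 1}) = 2 * n - 2"
    using assms by (subst card_Diff_subset) (auto simp: card_pverts_prism, auto simp: pverts_prism)
  then show ?thesis
    using leaky_forcing_number_le[OF prism_all_but_one_column_leaky_forcing[OF assms]] by simp
qed

section \<open>Combining the bounds\<close>

theorem theorem1p2:
  fixes n :: nat
  assumes "n \<ge> 3"
  shows "(\<forall>l. l \<in> {0, 1} \<and> n = 3 \<longrightarrow> leaky_forcing_number l (prism n) = 3) \<and>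
         (\<forall>l. (l \<in> {0, 1} \<and> n \<ge> 4) \<or> (l = 2 \<and> n = 3) \<longrightarrow> leaky_forcing_number l (prism n) = 4) \<and>
         (\<forall>l \<ge> 3. leaky_forcing_number l (prism n) = 2 * n) \<and>
         leaky_forcing_number 2 (prism 3) = 4 \<and>
         leaky_forcing_number 2 (prism 4) \<le> 6 \<and>
         (n > 4 \<longrightarrow> leaky_forcing_number 2 (prism n) \<le> n)"
proof -
  have card_U: "card (U ` {1..m}) = m" for m :: nat
    by (simp add: card_image inj_on_def)
  \<comment> \<open>The case of one leak gives that of none by monotonicity. For
    \<open>n = 3\<close> the \<open>U\<close>-cycle has one vertex fewer than two columns.\<close>
  have le3: "leaky_forcing_number l (prism 3) \<le> 3" if "l \<le> 1" for l
    using leaky_forcing_number_mono[OF that, of "prism 3"]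
      leaky_forcing_number_le[OF prism_U_cycle_leaky_forcing[of 3 1]] card_U[of 3] by simp
  have le4: "leaky_forcing_number l (prism n) \<le> 4" if "l \<le> 1" for l
    using leaky_forcing_number_mono[OF that, of "prism n"]
      leaky_forcing_number_le[OF prism_two_columns_leaky_forcing[OF assms]] by simp
  have eq4: "leaky_forcing_number 2 (prism 3) = 4"
    using prism_3_two_leaks_ge_4 prism_two_leaks_le[of 3] by simp
  \<comment> \<open>The prism is cubic, so three leaks reach the maximum degree and every vertex
    must be colored initially.\<close>
  have "leaky_forcing_number l (prism n) = 2 * n" if "l \<ge> 3" for l
    using that card_neighbors_prism[OF assms] card_pverts_prism
      pair_graph.leaky_forcing_number_max_degree[OF pair_graph_prism[OF assms], of l] by simp
  moreover have "leaky_forcing_number 2 (prism n) \<le> n" if "n > 4"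
    using leaky_forcing_number_le[OF prism_U_cycle_leaky_forcing[of n 2]] that card_U by simp
  moreover have "leaky_forcing_number 2 (prism 4) \<le> 6"
    using prism_two_leaks_le[of 4] by simp
  moreover have "leaky_forcing_number l (prism n) = 3" if "l \<in> {0, 1}" "n = 3" for l
    using that le3[of l] prism_leaky_forcing_number_ge_3[of 3 l] by auto
  moreover have "leaky_forcing_number l (prism n) = 4" if "l \<in> {0, 1}" "n \<ge> 4" for l
    using that le4[of l] prism_leaky_forcing_number_ge_4[of n l] by auto
  ultimately show ?thesis using eq4 by blast
qed

end
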